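(* Let $m,n,l,k$ be positive integers with $m\ge n\ge 2l\ge 2$ and $k\ge 3$. Let $G$ be a graph on $n$ vertices that has a matching consisting of $l$ end-edges, and let $H$ be a graph (on $n-l$ vertices) obtained from $G$ by removing $l$ leaves, one from each edge of a matching of $l$ end-edges. If $r(H,P_k)\le m-\left\lfloor\frac{3k}{2}\right\rfloor$, then $r(G,P_k)\le m+\left\lfloor\frac{k}{2}\right\rfloor-1$.
   Context: All graphs are finite and simple. For graphs $H_1,H_2$, the Ramsey number $r(H_1,H_2)$ is the smallest positive integer $N$ such that every graph $\Gamma$ on $N$ vertices contains $H_1$ as a (not necessarily induced) subgraph or its complement $\overline{\Gamma}$ contains $H_2$ as a subgraph. $P_k$ is the path on $k$ vertices. A leaf is a vertex of degree $1$; an end-edge is an edge incident to a leaf. *)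

theory Defs
  imports "HOL-Library.Ramsey" Complex_Main
begin

text \<open>Undirected graphs: an edge is a two-element set of vertices.\<close>

datatype 'a graph = Graph (verts: "'a set") (edges: "'a set set")

definition simple_graph :: "'a graph \<Rightarrow> bool" where
  "simple_graph G \<longleftrightarrow> finite (verts G) \<and> edges G \<subseteq> [verts G]\<^bsup>2\<^esup>"

definition graph_compl :: "'a graph \<Rightarrow> 'a graph" where
  "graph_compl G = Graph (verts G) ([verts G]\<^bsup>2\<^esup> - edges G)"

text \<open>\<open>contains G H\<close>: \<open>G\<close> has a not necessarily induced subgraph isomorphic to \<open>H\<close>.\<close>

definition contains :: "'b graph \<Rightarrow> 'a graph \<Rightarrow> bool" where
  "contains G H \<longleftrightarrow>
     (\<exists>f. inj_on f (verts H) \<and> f ` verts H \<subseteq> verts G \<and> (\<forall>e\<in>edges H. f ` e \<in> edges G))"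

definition path_graph :: "nat \<Rightarrow> nat graph" where
  "path_graph k = Graph {..<k} {{i, Suc i} |i. Suc i < k}"

definition degree :: "'a graph \<Rightarrow> 'a \<Rightarrow> nat" where
  "degree G v = card {e \<in> edges G. v \<in> e}"

definition leaf :: "'a graph \<Rightarrow> 'a \<Rightarrow> bool" where
  "leaf G v \<longleftrightarrow> v \<in> verts G \<and> degree G v = 1"

definition end_edge :: "'a graph \<Rightarrow> 'a set \<Rightarrow> bool" where
  "end_edge G e \<longleftrightarrow> e \<in> edges G \<and> (\<exists>v\<in>e. leaf G v)"

definition matching :: "'a graph \<Rightarrow> 'a set set \<Rightarrow> bool" where
  "matching G M \<longleftrightarrow> M \<subseteq> edges G \<and> pairwise disjnt M"

definition end_edge_matching :: "'a graph \<Rightarrow> nat \<Rightarrow> 'a set set \<Rightarrow> bool" where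
  "end_edge_matching G l M \<longleftrightarrow>
     matching G M \<and> finite M \<and> card M = l \<and> (\<forall>e\<in>M. end_edge G e)"

definition remove_verts :: "'a graph \<Rightarrow> 'a set \<Rightarrow> 'a graph" where
  "remove_verts G L = Graph (verts G - L) {e \<in> edges G. e \<inter> L = {}}"

text \<open>In \<open>leaf_removal G l H\<close> the function \<open>f\<close> selects the leaf to be removed from each edge
  of the matching; the choice is only a real one at components that are single edges.\<close>

definition leaf_removal :: "'a graph \<Rightarrow> nat \<Rightarrow> 'a graph \<Rightarrow> bool" where
  "leaf_removal G l H \<longleftrightarrow>
     (\<exists>M f. end_edge_matching G l M \<and> (\<forall>e\<in>M. f e \<in> e \<and> leaf G (f e)) \<and>
            H = remove_verts G (f ` M))"

text \<open>Since only the isomorphism type of \<open>\<Gamma>\<close> matters, it suffices to let \<open>\<Gamma>\<close> range over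
  graphs whose vertices are natural numbers.\<close>

definition ramsey_prop :: "'a graph \<Rightarrow> 'b graph \<Rightarrow> nat \<Rightarrow> bool" where
  "ramsey_prop H1 H2 N \<longleftrightarrow>
     (\<forall>\<Gamma>::nat graph. simple_graph \<Gamma> \<and> card (verts \<Gamma>) = N \<longrightarrow>
        contains \<Gamma> H1 \<or> contains (graph_compl \<Gamma>) H2)"

definition ramsey_number :: "'a graph \<Rightarrow> 'b graph \<Rightarrow> nat" where
  "ramsey_number H1 H2 = (LEAST N. N > 0 \<and> ramsey_prop H1 H2 N)"

text \<open>Ramsey's theorem: for simple graphs the minimum above is taken over a nonempty set.\<close>

lemma contains_if_clique:
  assumes H: "simple_graph H" and R: "R \<subseteq> verts G" "finite R" "card R = card (verts H)"
    and cl: "\<And>v w. v \<in> R \<Longrightarrow> w \<in> R \<Longrightarrow> v \<noteq> w \<Longrightarrow> {v, w} \<in> edges G"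
  shows "contains G H"
proof -
  have "finite (verts H)" using H by (simp add: simple_graph_def)
  then obtain f where f: "bij_betw f (verts H) R"
    using finite_same_card_bij[of "verts H" R] R by auto
  have "f ` e \<in> edges G" if e: "e \<in> edges H" for e
  proof -
    have "e \<in> [verts H]\<^bsup>2\<^esup>" using H e by (auto simp: simple_graph_def)
    then obtain x y where xy: "e = {x, y}" "x \<in> verts H" "y \<in> verts H" "x \<noteq> y"
      by (rule nsets2_E)
    then have "f x \<in> R" "f y \<in> R" "f x \<noteq> f y"
      using f by (auto simp: bij_betw_def inj_on_def)
    then show ?thesis using cl xy by simp
  qed
  then show ?thesis
    unfolding contains_def using f R(1) unfolding bij_betw_def
    by (intro exI[of _ f] conjI ballI) simp_all
qed

lemma ramsey_prop_ex:
  assumes "simple_graph H1" "simple_graph H2"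
  shows "\<exists>N>0. ramsey_prop H1 H2 N"
proof -
  obtain r where r: "r \<ge> 1" and ram: "\<forall>(V::nat set) E. finite V \<and> card V \<ge> r \<longrightarrow>
      (\<exists>R\<subseteq>V. card R = card (verts H1) \<and> clique R E \<or> card R = card (verts H2) \<and> indep R E)"
    using ramsey2[where 'a = nat, of "card (verts H1)" "card (verts H2)"] by (elim exE conjE)
  have "contains \<Gamma> H1 \<or> contains (graph_compl \<Gamma>) H2"
    if \<Gamma>: "simple_graph \<Gamma>" "card (verts \<Gamma>) = r" for \<Gamma> :: "nat graph"
  proof -
    have fin: "finite (verts \<Gamma>)" using \<Gamma> by (simp add: simple_graph_def)
    then obtain R where R: "R \<subseteq> verts \<Gamma>"
        "card R = card (verts H1) \<and> clique R (edges \<Gamma>) \<or>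
         card R = card (verts H2) \<and> indep R (edges \<Gamma>)"
      using ram[rule_format, of "verts \<Gamma>" "edges \<Gamma>"] \<Gamma>(2) by (auto simp only: order_refl)
    have finR: "finite R" using R fin finite_subset by blast
    from R(2) show ?thesis
    proof
      assume *: "card R = card (verts H1) \<and> clique R (edges \<Gamma>)"
      have "contains \<Gamma> H1"
        by (rule contains_if_clique[OF assms(1) R(1) finR]) (use * in \<open>auto simp: clique_def\<close>)
      then show ?thesis ..
    next
      assume *: "card R = card (verts H2) \<and> indep R (edges \<Gamma>)"
      have "contains (graph_compl \<Gamma>) H2"
        by (rule contains_if_clique[OF assms(2) _ finR])
          (use * R(1) in \<open>auto simp: indep_def graph_compl_def\<close>)
      then show ?thesis ..
    qed
  qed
  then show ?thesis using r unfolding ramsey_prop_def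
    by (intro exI[of _ r]) simp
qed

end

theory Submission
  imports Defs
begin

text \<open>
  Let \<open>F\<close> be the complement of a graph \<open>\<Gamma>\<close> on \<open>m + \<lfloor>k/2\<rfloor> - 1\<close> vertices and suppose that \<open>F\<close>
  has no path on \<open>k\<close> vertices. Depth-first search in \<open>F\<close> yields a set \<open>D\<close> of \<open>\<lfloor>k/2\<rfloor> - 1\<close> finished
  vertices and a stack \<open>xs\<close> of at most \<open>k - 1\<close> vertices such that \<open>\<Gamma>\<close> has all the edges between \<open>D\<close>
  and the unvisited vertices. The bound on \<open>r(H, P\<^sub>k)\<close> gives a copy of \<open>H\<close> among the unvisited
  vertices, and it remains to match the neighbours of the removed leaves into the complement \<open>R\<close> of
  that copy. A set \<open>A\<close> violating Hall's condition has at least \<open>\<lfloor>k/2\<rfloor>\<close> elements because of \<open>D\<close>,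
  and \<open>F\<close> is complete between \<open>A\<close> and the more than \<open>|R| - |A|\<close> vertices of \<open>R\<close> that \<open>A\<close> misses
  in \<open>\<Gamma>\<close>; this complete bipartite graph contains a path on \<open>k\<close> vertices.
\<close>

section \<open>Hall's marriage theorem\<close>

lemma hall:
  fixes N :: "'a \<Rightarrow> 'b set"
  assumes "finite S" and "\<And>s. s \<in> S \<Longrightarrow> finite (N s)"
    and "\<And>A. A \<subseteq> S \<Longrightarrow> card A \<le> card (\<Union> (N ` A))"
  shows "\<exists>g. inj_on g S \<and> (\<forall>s\<in>S. g s \<in> N s)"
  using assms
proof (induction "card S" arbitrary: S N rule: less_induct)
  case less
  note fin = less.prems(1) and finN = less.prems(2) and cond = less.prems(3)
  have finU: "finite (\<Union> (N ` A))" if "A \<subseteq> S" for A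
    using that fin finN by (auto intro: finite_subset)
  show ?case
  proof (cases "\<exists>A. A \<noteq> {} \<and> A \<subset> S \<and> card (\<Union> (N ` A)) = card A")
    case True
    then obtain A where A: "A \<noteq> {}" "A \<subset> S" "card (\<Union> (N ` A)) = card A" by blast
    let ?U = "\<Union> (N ` A)"
    have finA: "finite A" using A fin finite_subset by blast
    have "\<exists>g. inj_on g A \<and> (\<forall>s\<in>A. g s \<in> N s)"
      by (rule less.hyps) (use A fin finN cond finA in \<open>auto intro: psubset_card_mono\<close>)
    then obtain g where g: "inj_on g A" "\<forall>s\<in>A. g s \<in> N s" by blast
    \<comment> \<open>The tight set \<open>A\<close> exhausts its neighbourhood \<open>?U\<close>,
      so the other elements must avoid \<open>?U\<close>. Applying \<open>cond\<close> to
      \<open>B \<union> A\<close> and subtracting \<open>card ?U = card A\<close> shows that they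
      still satisfy Hall's condition.\<close>
    have "\<exists>g. inj_on g (S - A) \<and> (\<forall>s\<in>S - A. g s \<in> N s - ?U)"
    proof (rule less.hyps)
      show "card (S - A) < card S" using A fin by (intro psubset_card_mono) auto
      show "card B \<le> card (\<Union>s\<in>B. N s - ?U)" if B: "B \<subseteq> S - A" for B
      proof -
        have "card B + card A = card (B \<union> A)"
          using B finA fin by (subst card_Un_disjoint) (auto intro: finite_subset)
        also have "\<dots> \<le> card (\<Union> (N ` (B \<union> A)))" using B A by (intro cond) auto
        also have "\<Union> (N ` (B \<union> A)) = (\<Union>s\<in>B. N s - ?U) \<union> ?U" by auto
        also have "card \<dots> \<le> card (\<Union>s\<in>B. N s - ?U) + card ?U" by (rule card_Un_le)
        finally show ?thesis using A(3) by simp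
      qed
    qed (use fin finN in auto)
    then obtain g' where g': "inj_on g' (S - A)" "\<forall>s\<in>S - A. g' s \<in> N s - ?U" by blast
    let ?h = "\<lambda>s. if s \<in> A then g s else g' s"
    have "g ` A \<inter> g' ` (S - A) = {}" using g(2) g'(2) by fastforce
    then have "inj_on ?h (A \<union> (S - A))" by (rule inj_on_disjoint_Un[OF g(1) g'(1)])
    then have "inj_on ?h S" by (rule inj_on_subset) auto
    moreover have "\<forall>s\<in>S. ?h s \<in> N s" using g g' by auto
    ultimately show ?thesis by (intro exI[of _ ?h]) blast
  next
    case False
    show ?thesis
    proof (cases "S = {}")
      case True
      then show ?thesis by auto
    next
      case False
      then obtain s where s: "s \<in> S" by blast
      have "card {s} \<le> card (\<Union> (N ` {s}))" using s by (intro cond) auto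
      then obtain y where y: "y \<in> N s" by fastforce
      \<comment> \<open>No nonempty proper subset is tight, so each has a neighbour to spare;
        reserving \<open>y\<close> for \<open>s\<close> costs every such set at most one
        neighbour.\<close>
      have "\<exists>g. inj_on g (S - {s}) \<and> (\<forall>t\<in>S - {s}. g t \<in> N t - {y})"
      proof (rule less.hyps)
        show "card (S - {s}) < card S" using s fin by (intro psubset_card_mono) auto
        show "card B \<le> card (\<Union>t\<in>B. N t - {y})" if B: "B \<subseteq> S - {s}" for B
        proof (cases "B = {}")
          case False
          have "B \<subset> S" using B s by blast
          then have "card B < card (\<Union> (N ` B))"
            using cond[of B] False \<open>\<not> (\<exists>A. A \<noteq> {} \<and> A \<subset> S \<and> card (\<Union> (N ` A)) = card A)\<close>
            by (metis le_neq_implies_less psubset_imp_subset)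
          moreover have "(\<Union>t\<in>B. N t - {y}) = \<Union> (N ` B) - {y}" by auto
          ultimately show ?thesis
            using card_Diff1_le[of "\<Union> (N ` B)" y] by (auto simp: card_Diff_singleton_if)
        qed simp
      qed (use fin finN in auto)
      then obtain g where g: "inj_on g (S - {s})" "\<forall>t\<in>S - {s}. g t \<in> N t - {y}" by blast
      have "inj_on (g(s := y)) S"
        using g by (auto simp: inj_on_def)
      moreover have "\<forall>t\<in>S. (g(s := y)) t \<in> N t" using g y by auto
      ultimately show ?thesis by blast
    qed
  qed
qed

section \<open>Paths and depth-first search\<close>

lemma simple_path_graph: "simple_graph (path_graph k)"
  unfolding simple_graph_def path_graph_def by (auto simp: nsets_def)

lemma simple_remove_verts: "simple_graph G \<Longrightarrow> simple_graph (remove_verts G L)"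
  unfolding simple_graph_def remove_verts_def by (auto simp: nsets_def)

lemma edges_pair_iff:
  assumes "simple_graph G" "x \<in> verts G" "y \<in> verts G" "x \<noteq> y"
  shows "{x, y} \<in> edges (graph_compl G) \<longleftrightarrow> {x, y} \<notin> edges G"
  using assms by (auto simp: graph_compl_def nsets_def)

lemma contains_path_graphI:
  assumes "inj_on p {..<k}" "\<And>i. i < k \<Longrightarrow> p i \<in> verts F"
    and "\<And>i. Suc i < k \<Longrightarrow> {p i, p (Suc i)} \<in> edges F"
  shows "contains F (path_graph k)"
  unfolding contains_def path_graph_def
  using assms by (intro exI[of _ p]) auto

lemma contains_path_graph_list:
  assumes "distinct xs" "set xs \<subseteq> verts F" "successively (\<lambda>x y. {x, y} \<in> edges F) xs"
    and "k \<le> length xs"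
  shows "contains F (path_graph k)"
proof (rule contains_path_graphI)
  show "inj_on (\<lambda>i. xs ! i) {..<k}" using assms by (intro inj_on_nth) auto
qed (use assms in \<open>auto simp: successively_conv_nth subset_iff\<close>)

text \<open>The path alternates between the sides and starts in \<open>X\<close>: even positions run
  through an enumeration of \<open>X\<close>, odd ones through one of \<open>Y\<close>. With at most
  \<open>2 * h + 1\<close> positions this takes at most \<open>h + 1\<close> vertices of
  \<open>X\<close> and \<open>h\<close> of \<open>Y\<close>.\<close>

lemma contains_path_graph_bipartite:
  assumes XY: "X \<subseteq> verts F" "Y \<subseteq> verts F" "X \<inter> Y = {}" "finite X" "finite Y"
    and c: "h + 1 \<le> card X" "h \<le> card Y" and k: "k \<le> 2 * h + 1"
    and E: "\<And>x y. x \<in> X \<Longrightarrow> y \<in> Y \<Longrightarrow> {x, y} \<in> edges F"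
  shows "contains F (path_graph k)"
proof -
  obtain a where a: "bij_betw a {..<card X} X"
    using \<open>finite X\<close> finite_same_card_bij[of "{..<card X}" X] by auto
  obtain b where b: "bij_betw b {..<card Y} Y"
    using \<open>finite Y\<close> finite_same_card_bij[of "{..<card Y}" Y] by auto
  let ?p = "\<lambda>i::nat. if even i then a (i div 2) else b (i div 2)"
  have A: "a (i div 2) \<in> X" "i div 2 < card X" if "i < k" for i
  proof -
    show "i div 2 < card X" using that c k by linarith
    then show "a (i div 2) \<in> X" using a by (auto simp: bij_betw_def)
  qed
  have B: "b (i div 2) \<in> Y" "i div 2 < card Y" if "i < k" "odd i" for i
  proof -
    show "i div 2 < card Y" using that c k by presburger
    then show "b (i div 2) \<in> Y" using b by (auto simp: bij_betw_def)
  qed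
  show ?thesis
  proof (rule contains_path_graphI)
    show "inj_on ?p {..<k}"
    proof (rule inj_onI)
      fix i j assume ij: "i \<in> {..<k}" "j \<in> {..<k}" "?p i = ?p j"
      have par: "even i \<longleftrightarrow> even j"
        using ij A[of i] A[of j] B[of i] B[of j] XY(3) by (auto split: if_splits)
      have "i div 2 = j div 2"
      proof (cases "even i")
        case True
        then show ?thesis
          using ij par A[of i] A[of j] a by (auto simp: bij_betw_def inj_on_def)
      next
        case False
        then show ?thesis
          using ij par B[of i] B[of j] b by (auto simp: bij_betw_def inj_on_def)
      qed
      with par show "i = j" by presburger
    qed
    show "?p i \<in> verts F" if "i < k" for i
      using A[of i] B[of i] XY that by auto
    show "{?p i, ?p (Suc i)} \<in> edges F" if i: "Suc i < k" for i
    proof (cases "even i")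
      case True
      then show ?thesis using E[OF A(1)[of i] B(1)[of "Suc i"]] i by simp
    next
      case False
      then show ?thesis
        using E[OF A(1)[of "Suc i"] B(1)[of i]] i by (simp add: insert_commute)
    qed
  qed
qed

text \<open>\<open>D\<close> holds the finished vertices and \<open>xs\<close> the stack, its top at
  the end of the list. Among the states with \<open>d\<close> finished vertices, take one with a
  longest stack. It is nonempty, since otherwise any vertex outside \<open>D\<close> could be
  pushed, and its top has no unvisited neighbour, so the top can be finished.\<close>

lemma depth_first_search:
  assumes fin: "finite (verts F)" and "d \<le> card (verts F)"
  shows "\<exists>D xs. D \<subseteq> verts F \<and> card D = d \<and> distinct xs \<and> set xs \<subseteq> verts F \<and> D \<inter> set xs = {} \<and>
           successively (\<lambda>x y. {x, y} \<in> edges F) xs \<and>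
           (\<forall>x\<in>D. \<forall>y\<in>verts F - D - set xs. {x, y} \<notin> edges F)"
  using assms(2)
proof (induction d)
  case 0
  show ?case by (intro exI[of _ "{}"] exI[of _ "[]"]) auto
next
  case (Suc d)
  define P where "P D xs \<longleftrightarrow> D \<subseteq> verts F \<and> card D = d \<and> distinct xs \<and> set xs \<subseteq> verts F \<and>
           D \<inter> set xs = {} \<and> successively (\<lambda>x y. {x, y} \<in> edges F) xs \<and>
           (\<forall>x\<in>D. \<forall>y\<in>verts F - D - set xs. {x, y} \<notin> edges F)" for D xs
  have "\<exists>z. P (fst z) (snd z)" using Suc by (auto simp: P_def)
  \<comment> \<open>A stack has no repetitions, so its length is bounded and a longest one
    exists.\<close>
  moreover have "length (snd z) < Suc (card (verts F))" if "P (fst z) (snd z)" for z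
    using that card_mono[OF fin, of "set (snd z)"] by (simp add: P_def distinct_card)
  ultimately obtain z where z: "P (fst z) (snd z)"
    and max: "\<And>y. P (fst y) (snd y) \<Longrightarrow> length (snd y) \<le> length (snd z)"
    using ex_has_greatest_nat[of "\<lambda>z. P (fst z) (snd z)" _ "\<lambda>z. length (snd z)"]
    by (metis less_imp_le)
  obtain D xs where zD: "z = (D, xs)" by fastforce
  have P: "P D xs" and max: "\<And>ys. P D ys \<Longrightarrow> length ys \<le> length xs"
    using z max[of "(D, _)"] by (auto simp: zD)
  have finD: "finite D" using P fin finite_subset by (auto simp: P_def)
  show ?case
  proof (cases xs rule: rev_cases)
    case Nil
    have "D \<noteq> verts F" using P Suc by (auto simp: P_def)
    then obtain v where "v \<in> verts F - D" using P by (auto simp: P_def)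
    then have "P D [v]" using P by (auto simp: P_def Nil)
    then show ?thesis using max Nil by fastforce
  next
    case (snoc ys x)
    have "{x, y} \<notin> edges F" if y: "y \<in> verts F - D - set xs" for y
    proof
      assume "{x, y} \<in> edges F"
      then have "P D (xs @ [y])"
        using P y by (auto simp: P_def snoc successively_append_iff)
      then show False using max by fastforce
    qed
    \<comment> \<open>Moving \<open>x\<close> from the stack to \<open>D\<close> leaves the set of
      unvisited vertices unchanged.\<close>
    then show ?thesis
      using P finD
      by (intro exI[of _ "insert x D"] exI[of _ ys])
        (auto simp: P_def snoc successively_append_iff)
  qed
qed

section \<open>Ramsey numbers and induced subgraphs\<close>

lemma ramsey_number_props:
  assumes "simple_graph H1" "simple_graph H2"
  shows "ramsey_number H1 H2 > 0" "ramsey_prop H1 H2 (ramsey_number H1 H2)"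
  using LeastI_ex[OF ramsey_prop_ex[OF assms]] by (auto simp: ramsey_number_def)

lemma ramsey_number_le: "N > 0 \<Longrightarrow> ramsey_prop H1 H2 N \<Longrightarrow> ramsey_number H1 H2 \<le> N"
  unfolding ramsey_number_def by (rule Least_le) simp

text \<open>The property is applied to the subgraph induced on \<open>W\<close>: its non-edges are
  non-edges of \<open>\<Gamma>\<close>, so a copy of \<open>H2\<close> in its complement is
  excluded. The conclusion records that the copy of \<open>H1\<close> stays inside \<open>W\<close>;
  later \<open>W\<close> consists of unvisited vertices.\<close>

lemma ramsey_prop_on_subset:
  fixes \<Gamma> :: "nat graph"
  assumes "ramsey_prop H1 H2 (card W)" "simple_graph \<Gamma>" "W \<subseteq> verts \<Gamma>"
    and no: "\<not> contains (graph_compl \<Gamma>) H2"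
  obtains \<phi> where "inj_on \<phi> (verts H1)" "\<phi> ` verts H1 \<subseteq> W" "\<And>e. e \<in> edges H1 \<Longrightarrow> \<phi> ` e \<in> edges \<Gamma>"
proof -
  let ?\<Delta> = "Graph W (edges \<Gamma> \<inter> [W]\<^bsup>2\<^esup>)"
  have "simple_graph ?\<Delta>"
    using assms finite_subset by (auto simp: simple_graph_def)
  then have "contains ?\<Delta> H1 \<or> contains (graph_compl ?\<Delta>) H2"
    using assms(1) by (simp add: ramsey_prop_def)
  moreover have "contains (graph_compl \<Gamma>) H2" if "contains (graph_compl ?\<Delta>) H2"
  proof -
    have "verts (graph_compl ?\<Delta>) \<subseteq> verts (graph_compl \<Gamma>)"
      "edges (graph_compl ?\<Delta>) \<subseteq> edges (graph_compl \<Gamma>)"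
      using \<open>W \<subseteq> verts \<Gamma>\<close> by (auto simp: graph_compl_def nsets_def)
    then show ?thesis using that unfolding contains_def by (meson subset_iff)
  qed
  ultimately have "contains ?\<Delta> H1" using no by blast
  then show ?thesis using that unfolding contains_def by auto
qed

section \<open>Leaves, matchings and a bound on the order of \<open>H\<close>\<close>

lemma leaf_edge_unique:
  assumes "leaf G v" "e \<in> edges G" "v \<in> e" "e' \<in> edges G" "v \<in> e'"
  shows "e = e'"
proof -
  have "card {e \<in> edges G. v \<in> e} = 1" using assms(1) by (simp add: leaf_def degree_def)
  then obtain c where c: "{e \<in> edges G. v \<in> e} = {c}" by (rule card_1_singletonE)
  have "e \<in> {c}" "e' \<in> {c}" unfolding c[symmetric] using assms(2-5) by simp_all
  then show ?thesis by simp
qed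

text \<open>The embedding \<open>\<phi>\<close> is extended by sending each removed leaf
  \<open>f e\<close> to \<open>g e\<close>. An edge of \<open>G\<close> that meets a removed leaf is
  the matching edge at that leaf, because a leaf lies on one edge only; all other edges are handled
  by \<open>\<phi>\<close>.\<close>

lemma contains_if_leaf_matching:
  assumes G: "simple_graph G" and M: "matching G M"
    and f: "\<And>e. e \<in> M \<Longrightarrow> leaf G (f e)" "\<And>e. e \<in> M \<Longrightarrow> e = {f e, s e}"
    and injf: "inj_on f M"
    and \<phi>: "inj_on \<phi> (verts G - f ` M)" "\<phi> ` (verts G - f ` M) \<subseteq> verts \<Gamma>"
      "\<And>e. e \<in> edges (remove_verts G (f ` M)) \<Longrightarrow> \<phi> ` e \<in> edges \<Gamma>"
    and s: "s ` M \<inter> f ` M = {}"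
    and g: "inj_on g M" "g ` M \<subseteq> verts \<Gamma> - \<phi> ` (verts G - f ` M)"
      "\<And>e. e \<in> M \<Longrightarrow> {\<phi> (s e), g e} \<in> edges \<Gamma>"
  shows "contains \<Gamma> G"
proof -
  define \<psi> where "\<psi> v = (if v \<in> f ` M then g (inv_into M f v) else \<phi> v)" for v
  have \<psi>_leaf: "\<psi> (f e) = g e" if "e \<in> M" for e
    using that injf by (simp add: \<psi>_def)
  have \<psi>_other: "\<psi> v = \<phi> v" if "v \<notin> f ` M" for v
    using that by (simp add: \<psi>_def)
  have "inj_on \<psi> (f ` M)"
    using g(1) \<psi>_leaf by (auto simp: inj_on_def)
  moreover have "inj_on \<psi> (verts G - f ` M)"
    using \<phi>(1) \<psi>_other by (auto simp: inj_on_def)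
  moreover have "\<psi> ` (f ` M) \<inter> \<psi> ` (verts G - f ` M) = {}"
    using g(2) \<psi>_leaf \<psi>_other by force
  ultimately have "inj_on \<psi> (f ` M \<union> (verts G - f ` M))"
    by (subst inj_on_Un) auto
  then have "inj_on \<psi> (verts G)"
    by (rule inj_on_subset) auto
  moreover have "\<psi> ` verts G \<subseteq> verts \<Gamma>"
  proof
    fix y assume "y \<in> \<psi> ` verts G"
    then obtain v where v: "v \<in> verts G" "y = \<psi> v" by blast
    show "y \<in> verts \<Gamma>"
    proof (cases "v \<in> f ` M")
      case True
      then show ?thesis using v g(2) \<psi>_leaf by auto
    next
      case False
      then show ?thesis using v \<phi>(2) \<psi>_other by auto
    qed
  qed
  moreover have "\<psi> ` e \<in> edges \<Gamma>" if e: "e \<in> edges G" for e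
  proof (cases "e \<inter> f ` M = {}")
    case True
    then have "\<psi> ` e = \<phi> ` e" using \<psi>_other by (intro image_cong) blast+
    then show ?thesis using True e \<phi>(3) by (simp add: remove_verts_def)
  next
    case False
    then obtain e' where e': "e' \<in> M" "f e' \<in> e" by blast
    then have "e' \<in> edges G" using M by (auto simp: matching_def)
    moreover have "f e' \<in> e'" using f(2)[OF e'(1)] by blast
    ultimately have ee': "e = e'"
      using leaf_edge_unique[OF f(1)[OF e'(1)] e e'(2)] by blast
    have e_eq: "e = {f e', s e'}" unfolding ee' by (rule f(2)[OF e'(1)])
    have "s e' \<notin> f ` M" using s e' by blast
    then have "\<psi> ` e = {\<phi> (s e'), g e'}"
      using \<psi>_leaf \<psi>_other e' by (simp add: e_eq insert_commute)
    then show ?thesis using g(3) e' by simp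
  qed
  ultimately show ?thesis unfolding contains_def by blast
qed

lemma disjoint_edges_inj:
  assumes "matching G M" "\<And>e. e \<in> M \<Longrightarrow> f e \<in> e"
  shows "inj_on f M"
proof (rule inj_onI)
  fix e e' assume e: "e \<in> M" "e' \<in> M" "f e = f e'"
  then have "f e \<in> e \<inter> e'" using assms(2)[of e] assms(2)[of e'] by simp
  then show "e = e'"
    using assms(1) e by (auto simp: matching_def pairwise_def disjnt_def)
qed

text \<open>The complement of a complete graph has no edge, hence no path on
  \<open>k \<ge> 2\<close> vertices, so the complete graph on \<open>?r\<close> vertices must
  contain \<open>H\<close>.\<close>

lemma card_le_ramsey_number:
  assumes "simple_graph H" "k \<ge> 2"
  shows "card (verts H) \<le> ramsey_number H (path_graph k)"
proof -
  let ?r = "ramsey_number H (path_graph k)"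
  let ?K = "Graph {..<?r} ([{..<?r}]\<^bsup>2\<^esup>)"
  have no: "\<not> contains (graph_compl ?K) (path_graph k)"
  proof
    assume "contains (graph_compl ?K) (path_graph k)"
    moreover have "{0, Suc 0} \<in> edges (path_graph k)"
      using assms by (auto simp: path_graph_def)
    ultimately show False by (auto simp: contains_def graph_compl_def)
  qed
  have "ramsey_prop H (path_graph k) ?r"
    using ramsey_number_props[OF assms(1) simple_path_graph] by blast
  then have "contains ?K H"
    using no unfolding ramsey_prop_def by (auto simp: simple_graph_def dest: spec[of _ ?K])
  then show ?thesis
    using card_inj_on_le[of _ "verts H" "{..<?r}"] by (auto simp: contains_def)
qed

section \<open>Attaching the removed leaves\<close>

text \<open>This is the argument over the natural numbers. In the bound on the Ramsey number the
  term \<open>3 * k div 2\<close> stands on the left, so that no truncated subtraction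
  occurs.\<close>

lemma ramsey_prop_leaf_extension:
  fixes G :: "'a graph"
  assumes G: "simple_graph G" and M: "matching G M" "finite M"
    and f: "\<And>e. e \<in> M \<Longrightarrow> f e \<in> e" "\<And>e. e \<in> M \<Longrightarrow> leaf G (f e)"
    and m: "card (verts G) \<le> m"
    and k: "k \<ge> 2"
    and r: "ramsey_number (remove_verts G (f ` M)) (path_graph k) + 3 * k div 2 \<le> m"
  shows "ramsey_prop G (path_graph k) (m + k div 2 - 1)"
  unfolding ramsey_prop_def
proof (intro allI impI)
  fix \<Gamma> :: "nat graph"
  assume \<Gamma>: "simple_graph \<Gamma> \<and> card (verts \<Gamma>) = m + k div 2 - 1"
  define F where "F = graph_compl \<Gamma>"
  define H where "H = remove_verts G (f ` M)"
  define r where "r = ramsey_number H (path_graph k)"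
  note simple = conjunct1[OF \<Gamma>] and card\<Gamma> = conjunct2[OF \<Gamma>]
  have vF: "verts F = verts \<Gamma>" by (simp add: F_def graph_compl_def)
  have fin: "finite (verts \<Gamma>)" using simple by (simp add: simple_graph_def)
  have sH: "simple_graph H" using G by (simp add: H_def simple_remove_verts)
  have rm: "r + 3 * k div 2 \<le> m" using r by (simp add: r_def H_def)
  have Hr: "card (verts H) \<le> r" using card_le_ramsey_number[OF sH k] by (simp add: r_def)
  have vH: "verts H = verts G - f ` M" by (simp add: H_def remove_verts_def)
  have injf: "inj_on f M" using disjoint_edges_inj[OF M(1)] f by blast
  have finG: "finite (verts G)" using G by (simp add: simple_graph_def)
  have leaves: "f ` M \<subseteq> verts G" using f(2) by (auto simp: leaf_def)
  have cardH: "card (verts H) + card M = card (verts G)"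
    using leaves finG card_mono[OF finG leaves]
    by (simp add: vH card_Diff_subset finite_subset card_image[OF injf])
  have "\<exists>v. v \<in> verts G \<and> v \<noteq> f e \<and> e = {f e, v}" if "e \<in> M" for e
  proof -
    have "e \<in> [verts G]\<^bsup>2\<^esup>" using that M G by (auto simp: matching_def simple_graph_def)
    then obtain x y where "e = {x, y}" "x \<in> verts G" "y \<in> verts G" "x \<noteq> y"
      by (rule nsets2_E)
    then show ?thesis using f(1)[OF that] by auto
  qed
  then obtain s where s: "\<And>e. e \<in> M \<Longrightarrow> s e \<in> verts G" "\<And>e. e \<in> M \<Longrightarrow> s e \<noteq> f e"
      "\<And>e. e \<in> M \<Longrightarrow> e = {f e, s e}"
    by metis
  have s_in: "s e \<in> e" if "e \<in> M" for e using s(3)[OF that] by blast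
  have injs: "inj_on s M" using disjoint_edges_inj[OF M(1)] s_in by blast
  \<comment> \<open>Within one edge the two ends differ, and distinct edges of a matching are
    disjoint; so no neighbour \<open>s e\<close> is itself removed and \<open>\<phi>\<close> is
    defined on it.\<close>
  have sf: "s ` M \<inter> f ` M = {}"
  proof -
    have "s e \<noteq> f e'" if "e \<in> M" "e' \<in> M" for e e'
      using that M(1) s(2) s_in f(1) unfolding matching_def pairwise_def disjnt_def
      by (metis IntI empty_iff)
    then show ?thesis by auto
  qed
  have s_H: "s e \<in> verts H" if "e \<in> M" for e
    using that s(1) sf by (auto simp: vH)
  show "contains \<Gamma> G \<or> contains (graph_compl \<Gamma>) (path_graph k)"
  proof (rule disjCI)
    assume "\<not> contains (graph_compl \<Gamma>) (path_graph k)"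
    then have noP: "\<not> contains F (path_graph k)" by (simp add: F_def)
    have "k div 2 - 1 \<le> card (verts F)" using k card\<Gamma> by (simp add: vF)
    then obtain D xs where D: "D \<subseteq> verts \<Gamma>" "card D = k div 2 - 1"
      and xs: "distinct xs" "set xs \<subseteq> verts \<Gamma>" "D \<inter> set xs = {}"
        "successively (\<lambda>x y. {x, y} \<in> edges F) xs"
      and DU: "\<And>x y. x \<in> D \<Longrightarrow> y \<in> verts \<Gamma> - D - set xs \<Longrightarrow> {x, y} \<notin> edges F"
      using depth_first_search[of F "k div 2 - 1"] fin vF by metis
    have "length xs < k"
      using contains_path_graph_list[of xs F k] xs noP vF by (cases "length xs < k") auto
    then have "card (D \<union> set xs) \<le> k div 2 - 1 + (k - 1)"
      using D(2) card_Un_le[of D "set xs"] distinct_card[OF xs(1)] by linarith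
    moreover have "card (verts \<Gamma> - (D \<union> set xs)) = card (verts \<Gamma>) - card (D \<union> set xs)"
      using D xs fin by (intro card_Diff_subset) (auto intro: finite_subset)
    \<comment> \<open>After cancelling \<open>k div 2 - 1\<close> this is
      \<open>r + (k - 1) \<le> m\<close>, which follows from \<open>rm\<close>. It leaves room for a
      set \<open>W\<close> of exactly \<open>r\<close> unvisited vertices.\<close>
    moreover have "r + (k div 2 - 1 + (k - 1)) \<le> m + k div 2 - 1"
      using rm k by linarith
    ultimately have "r \<le> card (verts \<Gamma> - (D \<union> set xs))"
      using card\<Gamma> by linarith
    then obtain W where W: "W \<subseteq> verts \<Gamma> - (D \<union> set xs)" "card W = r"
      using obtain_subset_with_card_n by metis
    obtain \<phi> where \<phi>: "inj_on \<phi> (verts H)" "\<phi> ` verts H \<subseteq> W"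
        "\<And>e. e \<in> edges H \<Longrightarrow> \<phi> ` e \<in> edges \<Gamma>"
    proof (rule ramsey_prop_on_subset[of H "path_graph k" W \<Gamma>])
      show "ramsey_prop H (path_graph k) (card W)"
        using ramsey_number_props(2)[OF sH simple_path_graph] by (simp add: W r_def)
    qed (use W simple noP in \<open>auto simp: F_def\<close>)
    define R where "R = verts \<Gamma> - \<phi> ` verts H"
    have finR: "finite R" using fin by (simp add: R_def)
    have "\<phi> ` verts H \<subseteq> verts \<Gamma>" using \<phi>(2) W(1) by blast
    then have "card R + card (verts H) = card (verts \<Gamma>)"
      using fin card_mono[OF fin, of "\<phi> ` verts H"]
      by (simp add: R_def card_Diff_subset finite_subset card_image[OF \<phi>(1)])
    \<comment> \<open>Both bounds start from
      \<open>card R + card (verts H) = m + k div 2 - 1\<close>. \<open>R1\<close> uses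
      \<open>card (verts H) + card M \<le> m\<close>, \<open>R2\<close> uses
      \<open>card (verts H) \<le> r\<close>; they serve the two cases for \<open>card X\<close>
      below.\<close>
    then have R1: "card R + 1 \<ge> card M + k div 2" and R2: "card R + 1 \<ge> k div 2 + 3 * k div 2"
      using card\<Gamma> cardH m Hr rm by linarith+
    \<comment> \<open>The possible images in \<open>R\<close> of the leaf of \<open>e\<close>.
      Hall's theorem is applied with the edges of \<open>M\<close> as index set.\<close>
    define N where "N e = {y \<in> R. {\<phi> (s e), y} \<in> edges \<Gamma>}" for e
    have hall_cond: "card A \<le> card (\<Union> (N ` A))" if A: "A \<subseteq> M" for A
    proof (rule ccontr)
      assume less: "\<not> card A \<le> card (\<Union> (N ` A))"
      then have "A \<noteq> {}" by auto
      define X where "X = \<phi> ` s ` A"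
      define Y where "Y = R - \<Union> (N ` A)"
      have "inj_on s A" using injs A inj_on_subset by blast
      moreover have sA: "s ` A \<subseteq> verts H" using s_H A by blast
      then have "inj_on \<phi> (s ` A)" using \<phi>(1) inj_on_subset by blast
      ultimately have cardX: "card X = card A" by (simp add: X_def card_image)
      have X: "X \<subseteq> W" "X \<subseteq> \<phi> ` verts H" using sA \<phi>(2) by (auto simp: X_def)
      have XV: "X \<subseteq> verts \<Gamma>" using X W(1) by blast
      have disj: "X \<inter> Y = {}" using X(2) by (auto simp: Y_def R_def)
      have YV: "Y \<subseteq> verts \<Gamma>" by (auto simp: Y_def R_def)
      have finXY: "finite X" "finite Y" using XV YV fin finite_subset by blast+
      have E: "{x, y} \<in> edges F" if xy: "x \<in> X" "y \<in> Y" for x y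
      proof -
        have "{x, y} \<notin> edges \<Gamma>" using xy by (auto simp: X_def Y_def N_def)
        then show ?thesis
          using edges_pair_iff[OF simple, of x y] xy XV YV disj by (auto simp: F_def)
      qed
      \<comment> \<open>A single element of \<open>A\<close> suffices: its image under
        \<open>\<phi>\<close> and \<open>s\<close> lies in \<open>W\<close>, hence is unvisited and
        adjacent in \<open>\<Gamma>\<close> to all of \<open>D\<close>.\<close>
      have "D \<subseteq> \<Union> (N ` A)"
      proof
        fix d assume d: "d \<in> D"
        obtain e where e: "e \<in> A" using \<open>A \<noteq> {}\<close> by blast
        let ?x = "\<phi> (s e)"
        have x: "?x \<in> verts \<Gamma> - D - set xs" using e X(1) W(1) by (auto simp: X_def)
        then have "{d, ?x} \<in> edges \<Gamma>"
          using DU[OF d x] edges_pair_iff[OF simple, of d ?x] d D(1) by (auto simp: F_def)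
        moreover have "d \<in> R" using d D(1) \<phi>(2) W(1) by (auto simp: R_def)
        ultimately show "d \<in> \<Union> (N ` A)"
          using e by (auto simp: N_def insert_commute)
      qed
      moreover have NR: "\<Union> (N ` A) \<subseteq> R" by (auto simp: N_def)
      ultimately have "k div 2 - 1 \<le> card (\<Union> (N ` A))"
        using D(2) card_mono finR finite_subset by metis
      \<comment> \<open>The failure of Hall's condition is strict, which turns
        \<open>k div 2 - 1\<close> into \<open>k div 2\<close> here and supplies the
        \<open>+ 1\<close> in the bound \<open>Y\<close> below.\<close>
      then have h: "k div 2 \<le> card X" using less cardX k by linarith
      have "card Y + card (\<Union> (N ` A)) = card R"
        using finR NR card_mono[OF finR NR] by (simp add: Y_def card_Diff_subset finite_subset)
      then have Y: "card R + 1 \<le> card Y + card X" using less cardX by linarith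
      have XM: "card X \<le> card M" using cardX card_mono[OF M(2) A] by simp
      have "contains F (path_graph k)"
      \<comment> \<open>For odd \<open>k\<close> the side where the path starts needs
        \<open>k div 2 + 1\<close> vertices. If \<open>X\<close> has only \<open>k div 2\<close>,
        the path starts in \<open>Y\<close>, which is large by \<open>R2\<close>; otherwise it
        starts in \<open>X\<close>, and \<open>R1\<close> with \<open>XM\<close> gives
        \<open>k div 2\<close> vertices in \<open>Y\<close>.\<close>
      proof (cases "card X = k div 2")
        case True
        have "{y, x} \<in> edges F" if "y \<in> Y" "x \<in> X" for x y
          using E[OF that(2,1)] by (simp add: insert_commute)
        then show ?thesis
          by (intro contains_path_graph_bipartite[of Y F X "k div 2"])
            (use XV YV disj finXY vF True Y R2 k in auto)
      next
        case False
        show ?thesis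
          by (rule contains_path_graph_bipartite[of X F Y "k div 2"])
            (use E XV YV disj finXY vF False h Y R1 XM k in auto)
      qed
      then show False using noP by blast
    qed
    have "finite (N e)" for e using finR by (simp add: N_def)
    then obtain g where g: "inj_on g M" "\<forall>e\<in>M. g e \<in> N e"
      using hall[of M N] M(2) hall_cond by auto
    show "contains \<Gamma> G"
    proof (rule contains_if_leaf_matching[OF G M(1) f(2) s(3) injf _ _ _ sf g(1)])
      show "\<phi> ` e \<in> edges \<Gamma>" if "e \<in> edges (remove_verts G (f ` M))" for e
        using \<phi>(3) that by (simp add: H_def)
      show "g ` M \<subseteq> verts \<Gamma> - \<phi> ` (verts G - f ` M)"
        using g(2) by (auto simp: N_def R_def vH)
      show "{\<phi> (s e), g e} \<in> edges \<Gamma>" if "e \<in> M" for e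
        using g(2) that by (simp add: N_def)
    qed (use \<phi> W(1) in \<open>auto simp: vH\<close>)
  qed
qed

theorem lemma2p5:
  fixes m n l k :: nat and G H :: "'a graph"
  assumes "m \<ge> n" and "n \<ge> 2 * l" and "2 * l \<ge> 2" and "k \<ge> 3"
    and "simple_graph G" and "card (verts G) = n"
    and "\<exists>M. end_edge_matching G l M"
    and "leaf_removal G l H"
    and "int (ramsey_number H (path_graph k)) \<le> int m - \<lfloor>3 * real k / 2\<rfloor>"
  shows "int (ramsey_number G (path_graph k)) \<le> int m + \<lfloor>real k / 2\<rfloor> - 1"
proof -
  obtain M f where M: "end_edge_matching G l M" "\<forall>e\<in>M. f e \<in> e \<and> leaf G (f e)"
    and H: "H = remove_verts G (f ` M)"
    using assms(8) by (auto simp: leaf_removal_def)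
  have fl3: "\<lfloor>3 * real k / 2\<rfloor> = int (3 * k div 2)" and fl1: "\<lfloor>real k / 2\<rfloor> = int (k div 2)"
    using floor_divide_of_nat_eq[of "3 * k" 2, where 'a = real]
      floor_divide_of_nat_eq[of k 2, where 'a = real] by simp_all
  have "ramsey_prop G (path_graph k) (m + k div 2 - 1)"
  proof (rule ramsey_prop_leaf_extension[of G M f])
    show "ramsey_number (remove_verts G (f ` M)) (path_graph k) + 3 * k div 2 \<le> m"
      using assms(9) by (simp add: fl3 H)
  qed (use M assms in \<open>auto simp: end_edge_matching_def\<close>)
  \<comment> \<open>The Ramsey number is a minimum over positive integers only.\<close>
  moreover have "m + k div 2 - 1 > 0" using assms by linarith
  ultimately have "ramsey_number G (path_graph k) \<le> m + k div 2 - 1"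
    by (rule ramsey_number_le[rotated])
  \<comment> \<open>Since \<open>k \<ge> 3\<close> gives \<open>k div 2 \<ge> 1\<close>, the
    subtraction of 1 agrees with the one over the integers.\<close>
  then show ?thesis using assms(4) by (simp add: fl1)
qed

end
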